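(* Let $k \in \mathbb{N}$ and $\theta_k,\theta_{k+1} \in \Theta$, and suppose that $W_{\theta_k}^f$ takes values in $\{0,1\}$. Let $\pi_{\theta_k}^f(x) = \frac{1}{Z_w} W_{\theta_k}^f(x)\, p_{\theta_k}(x)$, and suppose that $p_{\theta_{k+1}}$ satisfies, for some $\Delta_k \in \mathbb{R}$ and some $\alpha\in(0,1)$, $$D_{\alpha}(\pi_{\theta_k}^f, p_{\theta_{k+1}}) + \Delta_k \leq D_{\alpha}(\pi_{\theta_k}^f, p_{\theta_k}).$$ Then $J(\theta_{k+1} | \theta_k) \geq \exp(\Delta_k)\, J(\theta_k | \theta_k) = \exp(\Delta_k)\, Z_w$. In particular, if $\Delta_k > 0$, then $J(\theta_{k+1} | \theta_k) > J(\theta_k | \theta_k) = Z_w$.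
   Context: Setting: $\mathbb{X}$ is a measurable space with a measure $m$, $f:\mathbb{X}\to\mathbb{R}$ is an objective function, and $\{p_\theta,\ \theta\in\Theta\}$ is a parametric family of probability distributions on $\mathbb{X}$, each having a density with respect to $m$, also denoted $p_\theta$. For $\theta\in\Theta$ and $x\in\mathbb{X}$, set $q_\theta^{<}(x) = \mathbb{P}_{X\sim p_\theta}[f(X)<f(x)]$ and $q_\theta^{\leq}(x) = \mathbb{P}_{X\sim p_\theta}[f(X)\leq f(x)]$. Weighting: $w:[0,1]\to\mathbb{R}_+$ is a non-increasing function and $Z_w=\int_0^1 w(u)\,du$ (assumed positive so that the target density below is defined). The preference function $W_\theta^f:\mathbb{X}\to\mathbb{R}$ is $W_\theta^f(x) = w(q_\theta^{\leq}(x))$ if $q_\theta^{\leq}(x)=q_\theta^{<}(x)$, and $W_\theta^f(x) = \frac{1}{q_\theta^{\leq}(x)-q_\theta^{<}(x)}\int_{q_\theta^{<}(x)}^{q_\theta^{\leq}(x)} w(u)\,du$ otherwise. Reformulated objective: $J(\theta|\theta') = \mathbb{E}_{X\sim p_\theta}[W_{\theta'}^f(X)]$ for $\theta,\theta'\in\Theta$. One has $J(\theta|\theta)=Z_w$ for every $\theta \in \Theta$, so that $\pi_\theta^f = \frac{1}{Z_w}W_\theta^f p_\theta$ is a probability density with respect to $m$. Rényi divergence: for $\alpha\in(0,1)\cup(1,+\infty)$ and probability densities $p_1,p_2$ with respect to $m$, $D_\alpha(p_1,p_2)=\frac{1}{\alpha-1}\ln\left(\int p_1(x)^\alpha p_2(x)^{1-\alpha}\,m(dx)\right)$.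 *)

theory Defs
  imports "HOL-Probability.Probability"
begin

abbreviation distr_of :: "'x measure \<Rightarrow> ('p \<Rightarrow> 'x \<Rightarrow> real) \<Rightarrow> 'p \<Rightarrow> 'x measure"
  where "distr_of m p t \<equiv> density m (\<lambda>x. ennreal (p t x))"

definition q_lt :: "'x measure \<Rightarrow> ('x \<Rightarrow> real) \<Rightarrow> ('p \<Rightarrow> 'x \<Rightarrow> real) \<Rightarrow> 'p \<Rightarrow> 'x \<Rightarrow> real"
  where "q_lt m f p t x = measure (distr_of m p t) {y \<in> space m. f y < f x}"

definition q_le :: "'x measure \<Rightarrow> ('x \<Rightarrow> real) \<Rightarrow> ('p \<Rightarrow> 'x \<Rightarrow> real) \<Rightarrow> 'p \<Rightarrow> 'x \<Rightarrow> real"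
  where "q_le m f p t x = measure (distr_of m p t) {y \<in> space m. f y \<le> f x}"

definition Z_w :: "(real \<Rightarrow> real) \<Rightarrow> real"
  where "Z_w w = (LBINT u:{0..1}. w u)"

definition pref ::
  "'x measure \<Rightarrow> ('x \<Rightarrow> real) \<Rightarrow> ('p \<Rightarrow> 'x \<Rightarrow> real) \<Rightarrow> (real \<Rightarrow> real) \<Rightarrow> 'p \<Rightarrow> 'x \<Rightarrow> real"
  where "pref m f p w t x =
    (if q_le m f p t x = q_lt m f p t x then w (q_le m f p t x)
     else 1 / (q_le m f p t x - q_lt m f p t x) *
            (LBINT u:{q_lt m f p t x..q_le m f p t x}. w u))"

text \<open>\<open>J_obj m f p w t t'\<close> is $J(t\,|\,t')$: the expectation under \<open>t\<close>, the preference from \<open>t'\<close>.\<close>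

definition J_obj ::
  "'x measure \<Rightarrow> ('x \<Rightarrow> real) \<Rightarrow> ('p \<Rightarrow> 'x \<Rightarrow> real) \<Rightarrow> (real \<Rightarrow> real) \<Rightarrow> 'p \<Rightarrow> 'p \<Rightarrow> real"
  where "J_obj m f p w t t' = (\<integral>x. pref m f p w t' x \<partial>(distr_of m p t))"

definition target_density ::
  "'x measure \<Rightarrow> ('x \<Rightarrow> real) \<Rightarrow> ('p \<Rightarrow> 'x \<Rightarrow> real) \<Rightarrow> (real \<Rightarrow> real) \<Rightarrow> 'p \<Rightarrow> 'x \<Rightarrow> real"
  where "target_density m f p w t x = 1 / Z_w w * pref m f p w t x * p t x"

text \<open>The divergence is extended-real-valued: for \<open>\<alpha> < 1\<close> and densities with disjoint supports the
  integral is 0 and the divergence is \<open>\<infinity>\<close>. The library's \<open>ln 0 = 0\<close> would give divergence 0 there,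
  hence the extended logarithm.\<close>

definition ln_ext :: "ennreal \<Rightarrow> ereal"
  where "ln_ext z = (if z = 0 then -\<infinity> else if z = \<top> then \<infinity> else ereal (ln (enn2real z)))"

text \<open>The integrand \<open>a\<^sup>\<alpha> b\<^sup>1\<^sup>-\<^sup>\<alpha>\<close>, with the usual conventions \<open>0\<^sup>\<alpha> 0\<^sup>1\<^sup>-\<^sup>\<alpha> = 0\<close> and, for \<open>\<alpha> > 1\<close>,
  \<open>a\<^sup>\<alpha> 0\<^sup>1\<^sup>-\<^sup>\<alpha> = \<infinity>\<close> if \<open>a > 0\<close>; note that \<open>0 powr s = 0\<close> also for \<open>s < 0\<close>.\<close>

definition renyi_integrand :: "real \<Rightarrow> real \<Rightarrow> real \<Rightarrow> ennreal"
  where "renyi_integrand \<alpha> a b =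
    (if 1 < \<alpha> \<and> a \<noteq> 0 \<and> b = 0 then \<top> else ennreal (a powr \<alpha> * b powr (1 - \<alpha>)))"

definition renyi_divergence :: "'x measure \<Rightarrow> real \<Rightarrow> ('x \<Rightarrow> real) \<Rightarrow> ('x \<Rightarrow> real) \<Rightarrow> ereal"
  where "renyi_divergence m \<alpha> g h =
    ereal (1 / (\<alpha> - 1)) * ln_ext (\<integral>\<^sup>+x. renyi_integrand \<alpha> (g x) (h x) \<partial>m)"

end

theory Submission
  imports Defs
begin

text \<open>
  Writing \<open>A = {W = 1}\<close> and \<open>P\<close>, \<open>Q\<close> for the old and the new distribution, the target density is that of
  \<open>P\<close> conditioned on \<open>A\<close>, so its divergence from \<open>P\<close> is exactly \<open>- ln (P A)\<close>, whereas by Hoelder's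
  inequality its divergence from \<open>Q\<close> is at least \<open>- ln (Q A)\<close>. The progress hypothesis therefore gives
  \<open>Q A \<ge> exp \<Delta> * P A\<close>, and \<open>P A = J(\<theta>|\<theta>) = Z\<close>.

  For \<open>J(\<theta>|\<theta>) = Z\<close>, let \<open>F\<close> be the distribution function of \<open>f(X)\<close> and realise \<open>f(X)\<close> by the quantile
  transform of a uniform \<open>u\<close>. Where \<open>F\<close> is continuous at the quantile, the preference is \<open>w u\<close>; at an
  atom it is the average of \<open>w\<close> over the fibre of the quantile transform, which is the interval from
  \<open>F(x-)\<close> to \<open>F(x)\<close>. There are only countably many atoms, so the integrals agree.
\<close>

section \<open>Means of a monotone weight over intervals\<close>

text \<open>The preference of \<open>x\<close> depends only on the two numbers \<open>q_lt\<close>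
  and \<open>q_le\<close>; isolating this dependence lets the computation take place on the real
  line, with \<open>a\<close> and \<open>b\<close> the left limit and the value of a distribution
  function. The case \<open>b = a\<close> is a point of continuity.\<close>

definition interval_mean :: "(real \<Rightarrow> real) \<Rightarrow> real \<Rightarrow> real \<Rightarrow> real"
  where "interval_mean w a b =
    (if b = a then w b else 1 / (b - a) * (LBINT u:{a..b}. w u))"

locale antimono_weight =
  fixes w :: "real \<Rightarrow> real"
  assumes antimono: "antimono_on {0..1} w"
    and nonneg: "\<And>u. u \<in> {0..1} \<Longrightarrow> 0 \<le> w u"
begin

text \<open>Monotone functions are Borel, and \<open>- w\<close> is monotone on the unit interval.
  The indicator is there because \<open>w\<close> is an arbitrary function outside that
  interval.\<close>

lemma measurable_indicator_weight [measurable]: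
  "(\<lambda>u. indicator {0..1} u * w u) \<in> borel_measurable borel"
proof -
  have "mono_on {0..1} (\<lambda>u. - w u)"
    using antimono by (auto simp: monotone_on_def)
  from borel_measurable_mono_on_fnc[OF this]
  have "(\<lambda>u. - (- w u)) \<in> borel_measurable (restrict_space borel {0..1})"
    by (rule borel_measurable_uminus)
  then show ?thesis
    by (simp add: borel_measurable_restrict_space_iff)
qed

lemma set_integrable_weight: "set_integrable lborel {0..1} w"
  unfolding set_integrable_def
proof (rule integrableI_bounded_set[where A = "{0..1}" and B = "w 0"])
  show "AE u in lborel. u \<in> {0..1} \<longrightarrow> norm (indicator {0..1} u *\<^sub>R w u) \<le> w 0"
    using antimono by (auto simp: monotone_on_def nonneg)
qed auto

lemma set_integrable_weight_subset:
  assumes "0 \<le> a" "b \<le> 1"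
  shows "set_integrable lborel {a..b} w"
  by (rule set_integrable_subset[OF set_integrable_weight]) (use assms in auto)

lemma set_nn_integral_weight:
  assumes "0 \<le> a" "b \<le> 1"
  shows "(\<integral>\<^sup>+u\<in>{a..b}. ennreal (w u) \<partial>lborel) = ennreal (LBINT u:{a..b}. w u)"
proof -
  have "(\<integral>\<^sup>+u\<in>{a..b}. ennreal (w u) \<partial>lborel)
      = (\<integral>\<^sup>+u. ennreal (indicator {a..b} u *\<^sub>R w u) \<partial>lborel)"
    by (rule nn_integral_cong) (auto simp: indicator_def)
  also have "\<dots> = ennreal (LBINT u:{a..b}. w u)"
    unfolding set_lebesgue_integral_def
    using assms set_integrable_weight_subset[OF assms] unfolding set_integrable_def
    by (intro nn_integral_eq_integral) (auto intro!: nonneg AE_I2 simp: indicator_def)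
  finally show ?thesis .
qed

lemma interval_mean_nonneg:
  assumes "0 \<le> a" "a \<le> b" "b \<le> 1"
  shows "0 \<le> interval_mean w a b"
  unfolding interval_mean_def set_lebesgue_integral_def
  using assms by (auto intro!: nonneg divide_nonneg_nonneg Bochner_Integration.integral_nonneg
      simp: indicator_def)

text \<open>The integral of \<open>w\<close> from \<open>a x\<close> to \<open>b x\<close> is a
  difference of two values of a primitive of \<open>w\<close>. The primitive is monotone because
  \<open>w\<close> is nonnegative, hence Borel, and measurability follows by composition.\<close>

lemma measurable_interval_mean:
  assumes [measurable]: "a \<in> borel_measurable N" "b \<in> borel_measurable N"
    and ab: "\<And>x. x \<in> space N \<Longrightarrow> 0 \<le> a x \<and> a x \<le> b x \<and> b x \<le> 1"
  shows "(\<lambda>x. interval_mean w (a x) (b x)) \<in> borel_measurable N"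
proof -
  \<comment> \<open>Intersecting with \<open>{0..1}\<close> makes \<open>H\<close> monotone on the
    whole real line, since \<open>w\<close> has no prescribed sign or integrability
    elsewhere.\<close>
  define H where "H v = (LBINT u:{0..v} \<inter> {0..1}. w u)" for v
  have int: "set_integrable lborel ({0..v} \<inter> {0..1}) w" for v
    by (rule set_integrable_subset[OF set_integrable_weight]) auto
  have "mono H"
  proof (rule monoI)
    fix v v' :: real assume "v \<le> v'"
    then show "H v \<le> H v'"
      using int[of v] int[of v'] unfolding H_def set_lebesgue_integral_def set_integrable_def
      by (intro integral_mono) (auto simp: indicator_def intro!: nonneg)
  qed
  then have [measurable]: "H \<in> borel_measurable borel"
    by (rule borel_measurable_mono)
  have H: "(LBINT u:{s..t}. w u) = H t - H s" if "0 \<le> s" "s \<le> t" "t \<le> 1" for s t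
  proof -
    have "H t = (LBINT u:{0..s} \<union> {s..t}. w u)"
      using that unfolding H_def by (intro arg_cong2[where f = "set_lebesgue_integral lborel"]) auto
    also have "\<dots> = (LBINT u:{0..s}. w u) + (LBINT u:{s..t}. w u)"
    proof (rule set_integral_Un_AE)
      show "AE u in lborel. \<not> (u \<in> {0..s} \<and> u \<in> {s..t})"
        using AE_lborel_singleton[of s] by eventually_elim auto
    qed (use that in \<open>auto intro!: set_integrable_weight_subset\<close>)
    also have "(LBINT u:{0..s}. w u) = H s"
      using that unfolding H_def by (intro arg_cong2[where f = "set_lebesgue_integral lborel"]) auto
    finally show ?thesis by simp
  qed
  have "(\<lambda>x. if b x = a x then indicator {0..1} (b x) * w (b x)
          else 1 / (b x - a x) * (H (b x) - H (a x))) \<in> borel_measurable N"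
    using measurable_compose[OF assms(2) measurable_indicator_weight] by measurable
  also have "?this \<longleftrightarrow> ?thesis"
    by (rule measurable_cong) (use ab in \<open>auto simp: interval_mean_def H indicator_def dest: ab\<close>)
  finally show ?thesis .
qed

end

section \<open>The quantile transform of a real distribution\<close>

context cdf_distribution
begin

text \<open>This is the left limit of the distribution function \<open>C\<close> at
  \<open>x\<close>, so \<open>C x - C_left x\<close> is its jump.\<close>

abbreviation C_left :: "real \<Rightarrow> real" where
  "C_left x \<equiv> measure M {..<x}"

lemma C_left_le_C: "C_left x \<le> C x"
  unfolding cdf_def by (rule finite_measure_mono) auto

lemma C_le_C_left: "y < x \<Longrightarrow> C y \<le> C_left x"
  unfolding cdf_def by (rule finite_measure_mono) auto

lemma measurable_C_left [measurable]: "C_left \<in> borel_measurable borel"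
  by (intro borel_measurable_mono monoI finite_measure_mono) auto

text \<open>By the Galois connection between \<open>C\<close> and its pseudoinverse
  \<open>I\<close>, every \<open>y < I u\<close> has \<open>C y < u\<close>; letting
  \<open>y\<close> increase to \<open>I u\<close> preserves the weak inequality.\<close>

lemma C_left_I_le:
  assumes "0 < u" "u < 1"
  shows "C_left (I u) \<le> u"
proof (rule tendsto_upperbound[OF cdf_at_left])
  have "C y \<le> u" if "y < I u" for y
    using pseudoinverse[OF assms, of y] that by linarith
  then show "\<forall>\<^sub>F y in at_left (I u). C y \<le> u"
    by (auto simp: eventually_at_filter)
qed simp

lemma le_C_I:
  assumes "0 < u" "u < 1"
  shows "u \<le> C (I u)"
  using pseudoinverse[OF assms, of "I u"] by simp

text \<open>Together with \<open>C_left_I_le\<close> and \<open>le_C_I\<close> this determines the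
  fibre of \<open>I\<close> over \<open>x\<close>, up to endpoints, as the interval from
  \<open>C_left x\<close> to \<open>C x\<close>.\<close>

lemma I_eqI:
  assumes "0 < u" "u < 1" "C_left x < u" "u \<le> C x"
  shows "I u = x"
proof (rule antisym)
  show "I u \<le> x" using pseudoinverse[OF assms(1,2)] assms(4) by blast
  show "x \<le> I u"
    using C_le_C_left[of "I u" x] le_C_I[OF assms(1,2)] assms(3) by linarith
qed

lemma nn_integral_interval_mean_cdf:
  assumes "antimono_weight w"
  shows "(\<integral>\<^sup>+x. ennreal (interval_mean w (C_left x) (C x)) \<partial>M)
    = ennreal (LBINT u:{0..1}. w u)"
proof -
  interpret antimono_weight w by fact
  define G where "G x = interval_mean w (C_left x) (C x)" for x
  have bounds: "0 \<le> C_left x" "C x \<le> 1" for x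
    by (auto simp: cdf_bounded_prob)
  have [measurable]: "G \<in> borel_measurable borel"
    unfolding G_def
    by (rule measurable_interval_mean) (auto simp: bounds C_left_le_C)
  \<comment> \<open>\<open>A\<close> is the set of jumps of \<open>C\<close>. A jump is the mass of
    a single point, and a finite measure has only countably many points of positive mass.\<close>
  define A where "A = {x. C_left x < C x}"
  have atom: "C x - C_left x = measure M {x}" for x
    unfolding cdf_def ivl_disj_un(2)[symmetric] by (subst finite_measure_Union) auto
  have cA: "countable A"
    using countable_support unfolding A_def by (rule countable_subset[rotated])
      (auto simp: less_le simp flip: atom)
  \<comment> \<open>The interval is open because \<open>I\<close> is characterised only for
    \<open>0 < u < 1\<close>; the endpoints are null.\<close>
  define U where "U = restrict_space lborel {0<..<1::real}"
  have [measurable]: "I \<in> borel_measurable U"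
    using measurable_CI unfolding U_def
    by (simp add: measurable_def sets_restrict_space space_restrict_space)
  have "(\<lambda>u. indicator {0<..<1} u * (indicator {0..1} u * w u)) \<in> borel_measurable borel"
    by (intro borel_measurable_times measurable_indicator_weight) auto
  also have "(\<lambda>u. indicator {0<..<1} u * (indicator {0..1} u * w u))
      = (\<lambda>u. indicator {0<..<1} u * w u)"
    by (auto simp: indicator_def)
  finally have [measurable]: "w \<in> borel_measurable U"
    by (simp add: U_def borel_measurable_restrict_space_iff cong: measurable_cong_sets)
  have spU: "space U = {0<..<1}" by (auto simp: U_def space_restrict_space)
  \<comment> \<open>The integrands \<open>G (I u)\<close> and \<open>w u\<close> may differ
    pointwise on the fibres over atoms. Read as densities of two measures, they can be compared
    fibre by fibre, and countable additivity then yields equal total mass.\<close>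
  define \<mu> where "\<mu> = density U (\<lambda>u. ennreal (G (I u)))"
  define \<nu> where "\<nu> = density U (\<lambda>u. ennreal (w u))"
  define S where "S x = {u \<in> space U. I u = x}" for x
  have [measurable]: "S x \<in> sets U" for x unfolding S_def by measurable
  have null: "AE u in U. u \<noteq> c" for c
    using AE_lborel_singleton[of c] unfolding U_def by (auto simp: AE_restrict_space_iff)
  \<comment> \<open>The fibre may miss the left endpoint of the interval, so the two sets agree only
    almost everywhere.\<close>
  have S_ae: "AE u in U. u \<in> S x \<longleftrightarrow> u \<in> {C_left x..C x}" if "x \<in> A" for x
    using null[of "C_left x"] null[of "C x"] AE_space
  proof eventually_elim
    case (elim u)
    then show ?case
      using C_left_I_le[of u] le_C_I[of u] I_eqI[of u x] by (auto simp: S_def spU)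
  qed
  have nnU: "(\<integral>\<^sup>+u\<in>{a..b}. g u \<partial>U) = (\<integral>\<^sup>+u\<in>{a..b}. g u \<partial>lborel)"
    if "0 \<le> a" "b \<le> 1" for g a b
    unfolding U_def
  proof (subst nn_integral_restrict_space)
    have "AE u in lborel. g u * indicator {a..b} u * indicator {0<..<1} u = g u * indicator {a..b} u"
      using AE_lborel_singleton[of 0] AE_lborel_singleton[of 1]
      by eventually_elim (use that in \<open>auto simp: indicator_def\<close>)
    then show "(\<integral>\<^sup>+u. g u * indicator {a..b} u * indicator {0<..<1} u \<partial>lborel)
        = (\<integral>\<^sup>+u\<in>{a..b}. g u \<partial>lborel)"
      by (rule nn_integral_cong_AE)
  qed auto
  \<comment> \<open>On the fibre over \<open>x\<close> the first density is the constant
    \<open>G x\<close>, the mean of \<open>w\<close> over an interval. Multiplied by the length of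
    that interval it becomes the integral of \<open>w\<close>, which is the mass given by the second
    density.\<close>
  have atoms: "emeasure \<mu> (S x) = emeasure \<nu> (S x)" if "x \<in> A" for x
  proof -
    have "emeasure \<mu> (S x) = (\<integral>\<^sup>+u. ennreal (G (I u)) * indicator (S x) u \<partial>U)"
      unfolding \<mu>_def by (rule emeasure_density) measurable
    also have "\<dots> = (\<integral>\<^sup>+u. ennreal (G x) * indicator {C_left x..C x} u \<partial>U)"
      by (rule nn_integral_cong_AE) (use S_ae[OF that] in eventually_elim, auto simp: S_def indicator_def)
    also have "\<dots> = ennreal (G x) * ennreal (C x - C_left x)"
      using that by (simp add: nnU bounds nn_integral_cmult A_def)
    also have "\<dots> = ennreal (G x * (C x - C_left x))"
      using that by (subst ennreal_mult'') (auto simp: A_def)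
    also have "G x * (C x - C_left x) = (LBINT u:{C_left x..C x}. w u)"
      using that by (simp add: G_def interval_mean_def A_def)
    also have "ennreal \<dots> = (\<integral>\<^sup>+u. ennreal (w u) * indicator {C_left x..C x} u \<partial>U)"
      by (simp add: nnU bounds set_nn_integral_weight)
    also have "\<dots> = (\<integral>\<^sup>+u. ennreal (w u) * indicator (S x) u \<partial>U)"
      by (rule nn_integral_cong_AE) (use S_ae[OF that] in eventually_elim, auto simp: indicator_def)
    also have "\<dots> = emeasure \<nu> (S x)"
      unfolding \<nu>_def by (rule emeasure_density[symmetric]) measurable
    finally show ?thesis .
  qed
  define T where "T = (\<Union>x\<in>A. S x)"
  have [measurable]: "T \<in> sets U"
    unfolding T_def using cA by (intro sets.countable_UN') auto
  have sets: "sets \<mu> = sets U" "sets \<nu> = sets U" by (auto simp: \<mu>_def \<nu>_def)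
  have disj: "disjoint_family_on S A" by (auto simp: disjoint_family_on_def S_def)
  have "emeasure \<mu> T = emeasure \<nu> T"
    unfolding T_def using cA disj
    by (subst (1 2) emeasure_UN_countable) (auto simp: sets atoms intro!: nn_integral_cong)
  moreover have "emeasure \<mu> (space U - T) = emeasure \<nu> (space U - T)"
  proof -
    \<comment> \<open>Off the fibres over atoms \<open>C\<close> has no jump at \<open>I u\<close>,
      so \<open>C_left (I u) \<le> u \<le> C (I u)\<close> pinches to equality and the mean
      degenerates to the point value \<open>w u\<close>.\<close>
    have "G (I u) = w u" if "u \<in> space U - T" for u
    proof -
      have "C_left (I u) = C (I u)"
        using that C_left_le_C[of "I u"] by (force simp: T_def A_def S_def)
      moreover have "C (I u) = u"
        using calculation C_left_I_le[of u] le_C_I[of u] that by (auto simp: spU)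
      ultimately show ?thesis by (simp add: G_def interval_mean_def)
    qed
    then show ?thesis
      unfolding \<mu>_def \<nu>_def by (auto simp: emeasure_density indicator_def intro!: nn_integral_cong)
  qed
  ultimately have "emeasure \<mu> (space U) = emeasure \<nu> (space U)"
    using plus_emeasure[of T \<mu> "space U - T"] plus_emeasure[of T \<nu> "space U - T"] sets
      sets.sets_into_space[of T U] by (simp add: Un_absorb1)
  then have "(\<integral>\<^sup>+u. ennreal (G (I u)) \<partial>U) = (\<integral>\<^sup>+u. ennreal (w u) \<partial>U)"
    unfolding \<mu>_def \<nu>_def by (simp add: emeasure_density cong: nn_integral_cong)
  moreover have "(\<integral>\<^sup>+x. ennreal (G x) \<partial>M) = (\<integral>\<^sup>+u. ennreal (G (I u)) \<partial>U)"
    by (subst distr_I_eq_M[symmetric], subst nn_integral_distr) (auto simp: U_def)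
  moreover have "(\<integral>\<^sup>+u. ennreal (w u) \<partial>U) = (\<integral>\<^sup>+u\<in>{0..1}. ennreal (w u) \<partial>lborel)"
    by (subst nnU[symmetric]) (auto intro!: nn_integral_cong simp: spU)
  ultimately show ?thesis
    unfolding G_def by (simp add: set_nn_integral_weight)
qed

end


section \<open>The preference function and its expectation\<close>

context
  fixes m :: "'x measure" and f :: "'x \<Rightarrow> real" and p :: "'p \<Rightarrow> 'x \<Rightarrow> real"
    and w :: "real \<Rightarrow> real" and t :: 'p
  assumes f [measurable]: "f \<in> borel_measurable m"
    and p [measurable]: "p t \<in> borel_measurable m"
    and prob: "prob_space (distr_of m p t)"
    and w: "antimono_weight w"
begin

lemma cdf_distribution_distr: "cdf_distribution (distr (distr_of m p t) borel f)"
proof -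
  interpret P: prob_space "distr_of m p t" by (rule prob)
  show ?thesis
    unfolding cdf_distribution_def by (rule P.real_distribution_distr) simp
qed

text \<open>\<open>q_lt\<close> and \<open>q_le\<close> are the left limit and the value, at
  \<open>f x\<close>, of the distribution function of \<open>f\<close> under
  \<open>distr_of m p t\<close>. Questions about the preference thus pass to the push-forward along
  \<open>f\<close>.\<close>

lemma pref_eq_interval_mean:
  "pref m f p w t x
    = interval_mean w (measure (distr (distr_of m p t) borel f) {..<f x})
        (cdf (distr (distr_of m p t) borel f) (f x))"
proof -
  have "q_lt m f p t x = measure (distr (distr_of m p t) borel f) {..<f x}"
    unfolding q_lt_def by (subst measure_distr) (auto intro!: arg_cong2[where f = measure])
  moreover have "q_le m f p t x = cdf (distr (distr_of m p t) borel f) (f x)"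
    unfolding q_le_def cdf_def by (subst measure_distr) (auto intro!: arg_cong2[where f = measure])
  ultimately show ?thesis
    unfolding pref_def interval_mean_def by simp
qed

lemma pref_nonneg: "0 \<le> pref m f p w t x"
proof -
  interpret antimono_weight w by (rule w)
  interpret D: cdf_distribution "distr (distr_of m p t) borel f" by (rule cdf_distribution_distr)
  show ?thesis
    unfolding pref_eq_interval_mean
    by (rule interval_mean_nonneg) (auto simp: D.C_left_le_C D.cdf_bounded_prob)
qed

lemma measurable_pref: "pref m f p w t \<in> borel_measurable m"
proof -
  interpret antimono_weight w by (rule w)
  interpret D: cdf_distribution "distr (distr_of m p t) borel f" by (rule cdf_distribution_distr)
  show ?thesis
    unfolding pref_eq_interval_mean[abs_def]
    by (rule measurable_interval_mean)
       (auto simp: D.C_left_le_C D.cdf_bounded_prob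
         intro: measurable_compose[OF f D.measurable_C_left] measurable_compose[OF f D.measurable_C])
qed

lemma nn_integral_pref: "(\<integral>\<^sup>+x. ennreal (pref m f p w t x) \<partial>distr_of m p t) = ennreal (Z_w w)"
proof -
  interpret antimono_weight w by (rule w)
  let ?M = "distr (distr_of m p t) borel f"
  interpret D: cdf_distribution ?M by (rule cdf_distribution_distr)
  have [measurable]: "(\<lambda>y. interval_mean w (D.C_left y) (D.C y)) \<in> borel_measurable borel"
    by (rule measurable_interval_mean) (auto simp: D.C_left_le_C D.cdf_bounded_prob)
  have "(\<integral>\<^sup>+x. ennreal (pref m f p w t x) \<partial>distr_of m p t)
      = (\<integral>\<^sup>+y. ennreal (interval_mean w (D.C_left y) (D.C y)) \<partial>?M)"
    unfolding pref_eq_interval_mean by (rule nn_integral_distr[symmetric]) measurable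
  also have "\<dots> = ennreal (Z_w w)"
    unfolding Z_w_def by (rule D.nn_integral_interval_mean_cdf[OF w])
  finally show ?thesis .
qed

lemma J_obj_self: "0 \<le> Z_w w \<Longrightarrow> J_obj m f p w t t = Z_w w"
  unfolding J_obj_def using measurable_pref nn_integral_pref
  by (subst integral_eq_nn_integral) (auto simp: pref_nonneg)

end

section \<open>Estimates for the Renyi divergence\<close>

text \<open>Let \<open>N\<close> be the \<open>h\<close>-mass of the support of \<open>g\<close>. As
  \<open>g\<close> has integral 1, Hoelder's inequality bounds the integral \<open>S\<close> of
  \<open>g powr \<alpha> * h powr (1 - \<alpha>)\<close> by \<open>N\<close> to the power
  \<open>1 - \<alpha>\<close>; the logarithm is then multiplied by the negative factor
  \<open>1 / (\<alpha> - 1)\<close>, which reverses the inequality.\<close>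

lemma renyi_divergence_ge:
  assumes [measurable]: "g \<in> borel_measurable m" "h \<in> borel_measurable m"
    and nonneg: "\<And>x. x \<in> space m \<Longrightarrow> 0 \<le> g x" "\<And>x. x \<in> space m \<Longrightarrow> 0 \<le> h x"
    and g: "(\<integral>\<^sup>+x. ennreal (g x) \<partial>m) = 1"
    and \<alpha>: "0 < \<alpha>" "\<alpha> < 1"
    and fin: "(\<integral>\<^sup>+x. ennreal (h x) * indicator {x. g x \<noteq> 0} x \<partial>m) \<noteq> \<top>"
  shows "- ln_ext (\<integral>\<^sup>+x. ennreal (h x) * indicator {x. g x \<noteq> 0} x \<partial>m)
    \<le> renyi_divergence m \<alpha> g h"
proof -
  define N where "N = (\<integral>\<^sup>+x. ennreal (h x) * indicator {x. g x \<noteq> 0} x \<partial>m)"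
  define S where "S = (\<integral>\<^sup>+x. ennreal (g x powr \<alpha> * h x powr (1 - \<alpha>)) \<partial>m)"
  have D: "renyi_divergence m \<alpha> g h = ereal (1 / (\<alpha> - 1)) * ln_ext S"
    using \<alpha> by (simp add: renyi_divergence_def renyi_integrand_def S_def)
  have D0: "renyi_divergence m \<alpha> g h = \<infinity>" if "S = 0"
    using \<alpha> that unfolding D by (simp add: ln_ext_def)
  show ?thesis
  proof (cases "S = 0")
    case False
    have meas: "(\<lambda>x. ennreal (h x) * indicator {x. g x \<noteq> 0} x) \<in> borel_measurable m"
      by measurable
    obtain J where J: "N = ennreal J" "0 \<le> J"
      using fin unfolding N_def[symmetric] by (cases N) auto
    \<comment> \<open>If \<open>N\<close> were 0, then \<open>h\<close> would vanish almost
      everywhere on the support of \<open>g\<close>, and the integrand of \<open>S\<close> with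
      it.\<close>
    have "N \<noteq> 0"
    proof
      assume "N = 0"
      then have "AE x in m. ennreal (h x) * indicator {x. g x \<noteq> 0} x = 0"
        using nn_integral_0_iff_AE[OF meas] unfolding N_def by simp
      then have "AE x in m. ennreal (g x powr \<alpha> * h x powr (1 - \<alpha>)) = 0"
        using AE_space by eventually_elim (use nonneg in \<open>force simp: indicator_def split: if_splits\<close>)
      then have "S = 0"
        unfolding S_def by (subst nn_integral_0_iff_AE) auto
      with False show False ..
    qed
    with J have Jpos: "0 < J" by (cases "J = 0") auto
    \<comment> \<open>Hoelder's inequality is obtained from Young's, applied pointwise to
      \<open>g x\<close> and \<open>h x / J\<close>. The rescaling gives both unit mass on the
      support of \<open>g\<close>, so the weights \<open>\<alpha>\<close> and
      \<open>1 - \<alpha>\<close> add up to 1 and the bound is exactly \<open>c\<close>, the factor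
      released by the rescaling. \<open>d\<close> is the coefficient of \<open>h x\<close> in
      Young's bound.\<close>
    define c where "c = J powr (1 - \<alpha>)"
    have "0 \<le> c" by (simp add: c_def)
    define d where "d = (1 - \<alpha>) / J"
    have "0 \<le> d" using \<alpha> Jpos by (simp add: d_def)
    have "S \<le> (\<integral>\<^sup>+x. ennreal (c * \<alpha>) * ennreal (g x)
        + ennreal (c * d) * (ennreal (h x) * indicator {x. g x \<noteq> 0} x) \<partial>m)"
      unfolding S_def
    proof (rule nn_integral_mono)
      fix x assume x: "x \<in> space m"
      show "ennreal (g x powr \<alpha> * h x powr (1 - \<alpha>)) \<le> ennreal (c * \<alpha>) * ennreal (g x)
        + ennreal (c * d) * (ennreal (h x) * indicator {x. g x \<noteq> 0} x)"
      proof (cases "g x = 0 \<or> h x = 0")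
        case False
        with nonneg x have pos: "0 < g x" "0 < h x" by (force simp: less_le)+
        have "g x powr \<alpha> * h x powr (1 - \<alpha>) = c * (g x powr \<alpha> * (h x / J) powr (1 - \<alpha>))"
          using Jpos pos by (simp add: c_def powr_divide)
        also have "\<dots> \<le> c * (\<alpha> * g x + (1 - \<alpha>) * (h x / J))"
          using \<alpha> pos Jpos \<open>0 \<le> c\<close> by (intro mult_left_mono Youngs_inequality_0) auto
        also have "\<dots> = c * \<alpha> * g x + c * d * h x"
          by (simp add: d_def algebra_simps)
        finally have "ennreal (g x powr \<alpha> * h x powr (1 - \<alpha>))
            \<le> ennreal (c * \<alpha> * g x + c * d * h x)"
          by (rule ennreal_leI)
        also have "\<dots> = ennreal (c * \<alpha>) * ennreal (g x) + ennreal (c * d) * ennreal (h x)"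
          using pos \<alpha> \<open>0 \<le> c\<close> \<open>0 \<le> d\<close> by (simp add: ennreal_plus ennreal_mult)
        finally show ?thesis using pos by simp
      qed auto
    qed
    also have "\<dots> = ennreal (c * \<alpha>) * 1 + ennreal (c * d) * ennreal J"
      by (simp add: nn_integral_add nn_integral_cmult g N_def[symmetric] J)
    also have "\<dots> = ennreal (c * \<alpha> + c * d * J)"
      using \<alpha> Jpos \<open>0 \<le> c\<close> \<open>0 \<le> d\<close> by (simp add: ennreal_plus ennreal_mult)
    also have "c * \<alpha> + c * d * J = c"
      using Jpos by (simp add: d_def field_simps)
    finally have "S \<le> ennreal c" .
    then obtain s where s: "S = ennreal s" "0 < s" "s \<le> c"
      using False \<open>0 \<le> c\<close> by (cases S) (auto simp: top_unique less_le)
    have "ln s \<le> (1 - \<alpha>) * ln J"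
      using s Jpos ln_mono[of s c] by (simp add: c_def ln_powr)
    then have "- ln J \<le> 1 / (\<alpha> - 1) * ln s"
      using \<alpha> by (simp add: field_simps)
    then show ?thesis
      unfolding D N_def[symmetric] using s Jpos by (simp add: ln_ext_def J)
  qed (simp add: D0)
qed

text \<open>A function with values 0 and 1 equals its own power \<open>\<alpha>\<close>, so the
  integrand collapses to \<open>Z powr - \<alpha> * (u x * h x)\<close> and its integral is
  \<open>Z powr (1 - \<alpha>)\<close>. The factor \<open>1 / (\<alpha> - 1)\<close> turns the
  logarithm of this into \<open>- ln Z\<close>.\<close>

lemma renyi_divergence_restrict:
  assumes [measurable]: "u \<in> borel_measurable m" "h \<in> borel_measurable m"
    and u: "\<And>x. x \<in> space m \<Longrightarrow> u x \<in> {0, 1}"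
    and h: "\<And>x. x \<in> space m \<Longrightarrow> 0 \<le> h x"
    and Z: "(\<integral>\<^sup>+x. ennreal (u x * h x) \<partial>m) = ennreal Z" "0 < Z"
    and \<alpha>: "0 < \<alpha>" "\<alpha> < 1"
  shows "renyi_divergence m \<alpha> (\<lambda>x. 1 / Z * u x * h x) h = ereal (- ln Z)"
proof -
  have "(\<integral>\<^sup>+x. renyi_integrand \<alpha> (1 / Z * u x * h x) (h x) \<partial>m)
      = (\<integral>\<^sup>+x. ennreal (Z powr - \<alpha>) * ennreal (u x * h x) \<partial>m)"
  proof (rule nn_integral_cong)
    fix x assume x: "x \<in> space m"
    have "h x powr \<alpha> * h x powr (1 - \<alpha>) = h x"
      using h[OF x] by (simp flip: powr_add)
    then have "(1 / Z * u x * h x) powr \<alpha> * h x powr (1 - \<alpha>) = Z powr - \<alpha> * (u x * h x)"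
      using u[OF x] h[OF x] Z(2) by (auto simp: powr_divide powr_minus field_simps)
    then show "renyi_integrand \<alpha> (1 / Z * u x * h x) (h x)
        = ennreal (Z powr - \<alpha>) * ennreal (u x * h x)"
      using \<alpha> by (simp add: renyi_integrand_def ennreal_mult')
  qed
  also have "\<dots> = ennreal (Z powr - \<alpha>) * ennreal (Z powr 1)"
    using Z by (simp add: nn_integral_cmult)
  also have "\<dots> = ennreal (Z powr (1 - \<alpha>))"
    using powr_add[of Z "- \<alpha>" 1] by (subst ennreal_mult[symmetric]) auto
  finally have "(\<integral>\<^sup>+x. renyi_integrand \<alpha> (1 / Z * u x * h x) (h x) \<partial>m)
      = ennreal (Z powr (1 - \<alpha>))" .
  then show ?thesis
    unfolding renyi_divergence_def using Z(2) \<alpha> by (simp add: ln_ext_def ln_powr field_simps)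
qed

section \<open>From decrease of the divergence to increase of the objective\<close>

theorem proposition2:
  fixes m :: "'x measure"
    and f :: "'x \<Rightarrow> real"
    and \<Theta> :: "'p set"
    and p :: "'p \<Rightarrow> 'x \<Rightarrow> real"
    and w :: "real \<Rightarrow> real"
    and \<theta> :: "nat \<Rightarrow> 'p"
    and k :: nat
    and \<Delta> \<alpha> :: real
  assumes f_meas: "f \<in> borel_measurable m"
    and p_meas: "\<And>t. t \<in> \<Theta> \<Longrightarrow> p t \<in> borel_measurable m"
    and p_nonneg: "\<And>t x. t \<in> \<Theta> \<Longrightarrow> x \<in> space m \<Longrightarrow> 0 \<le> p t x"
    and p_prob: "\<And>t. t \<in> \<Theta> \<Longrightarrow> prob_space (distr_of m p t)"
    and w_nonneg: "\<And>u. u \<in> {0..1} \<Longrightarrow> 0 \<le> w u"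
    and w_antimono: "antimono_on {0..1} w"
    and Z_pos: "0 < Z_w w"
    and \<theta>_k: "\<theta> k \<in> \<Theta>"
    and \<theta>_Suc_k: "\<theta> (Suc k) \<in> \<Theta>"
    and pref_01: "\<And>x. x \<in> space m \<Longrightarrow> pref m f p w (\<theta> k) x \<in> {0, 1}"
    and \<alpha>: "0 < \<alpha>" "\<alpha> < 1"
    and progress:
      "renyi_divergence m \<alpha> (target_density m f p w (\<theta> k)) (p (\<theta> (Suc k))) + ereal \<Delta>
        \<le> renyi_divergence m \<alpha> (target_density m f p w (\<theta> k)) (p (\<theta> k))"
  shows "J_obj m f p w (\<theta> (Suc k)) (\<theta> k) \<ge> exp \<Delta> * J_obj m f p w (\<theta> k) (\<theta> k)
    \<and> exp \<Delta> * J_obj m f p w (\<theta> k) (\<theta> k) = exp \<Delta> * Z_w w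
    \<and> (\<Delta> > 0 \<longrightarrow>
         J_obj m f p w (\<theta> (Suc k)) (\<theta> k) > J_obj m f p w (\<theta> k) (\<theta> k)
         \<and> J_obj m f p w (\<theta> k) (\<theta> k) = Z_w w)"
proof -
  let ?W = "pref m f p w (\<theta> k)" and ?g = "target_density m f p w (\<theta> k)"
  let ?P = "p (\<theta> k)" and ?Q = "p (\<theta> (Suc k))" and ?Z = "Z_w w"
  let ?J = "J_obj m f p w (\<theta> (Suc k)) (\<theta> k)"
  have w: "antimono_weight w"
    using w_antimono w_nonneg by (rule antimono_weight.intro)
  note [measurable] = p_meas[OF \<theta>_k] p_meas[OF \<theta>_Suc_k] f_meas
  note ctxt = f_meas p_meas[OF \<theta>_k] p_prob[OF \<theta>_k] w
  have [measurable]: "?W \<in> borel_measurable m"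
    by (rule measurable_pref[where t = "\<theta> k" and p = p, OF ctxt])
  have Jk: "J_obj m f p w (\<theta> k) (\<theta> k) = ?Z"
    using J_obj_self[where t = "\<theta> k" and p = p, OF ctxt] Z_pos by simp
  have WP: "(\<integral>\<^sup>+x. ennreal (?W x * ?P x) \<partial>m) = ennreal ?Z"
  proof -
    have "ennreal ?Z = (\<integral>\<^sup>+x. ennreal (?P x) * ennreal (?W x) \<partial>m)"
      by (subst nn_integral_pref[where t = "\<theta> k" and p = p, OF ctxt, symmetric]) (simp add: nn_integral_density)
    also have "\<dots> = (\<integral>\<^sup>+x. ennreal (?W x * ?P x) \<partial>m)"
      using pref_nonneg[where t = "\<theta> k" and p = p, OF ctxt] by (intro nn_integral_cong) (simp add: ennreal_mult'' mult.commute)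
    finally show ?thesis ..
  qed
  have g_def: "?g = (\<lambda>x. 1 / ?Z * ?W x * ?P x)"
    by (simp add: target_density_def fun_eq_iff)
  have Dk: "renyi_divergence m \<alpha> ?g ?P = ereal (- ln ?Z)"
    unfolding g_def using pref_01 p_nonneg[OF \<theta>_k] WP Z_pos \<alpha>
    by (intro renyi_divergence_restrict) auto
  define N where "N = (\<integral>\<^sup>+x. ennreal (?Q x) * indicator {x. ?g x \<noteq> 0} x \<partial>m)"
  interpret Q: prob_space "distr_of m p (\<theta> (Suc k))" by (rule p_prob[OF \<theta>_Suc_k])
  have int_W: "integrable (distr_of m p (\<theta> (Suc k))) ?W"
    by (rule Q.integrable_const_bound[where B = 1]) (use pref_01 in \<open>force intro!: AE_I2\<close>)+
  \<comment> \<open>Where \<open>?g\<close> is nonzero, \<open>?W\<close> is 1. The converse can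
    fail, since \<open>?g\<close> also vanishes where \<open>?P\<close> does, so this is an
    inequality; it points in the direction required for a lower bound on \<open>?J\<close>.\<close>
  have "N \<le> (\<integral>\<^sup>+x. ennreal (?Q x) * ennreal (?W x) \<partial>m)"
    unfolding N_def g_def using pref_01 by (intro nn_integral_mono) (force simp: indicator_def)
  also have "\<dots> = (\<integral>\<^sup>+x. ennreal (?W x) \<partial>distr_of m p (\<theta> (Suc k)))"
    by (simp add: nn_integral_density)
  also have "\<dots> = ennreal ?J"
    unfolding J_obj_def using int_W pref_nonneg[where t = "\<theta> k" and p = p, OF ctxt] by (intro nn_integral_eq_integral) auto
  finally have N_le: "N \<le> ennreal ?J" .
  have "(\<integral>\<^sup>+x. ennreal (?g x) \<partial>m) = (\<integral>\<^sup>+x. ennreal (1 / ?Z) * ennreal (?W x * ?P x) \<partial>m)"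
    using Z_pos unfolding g_def by (intro nn_integral_cong) (simp add: mult.assoc flip: ennreal_mult')
  also have "\<dots> = ennreal (1 / ?Z) * ennreal ?Z"
    by (simp add: nn_integral_cmult WP)
  also have "\<dots> = 1"
    using Z_pos by (simp flip: ennreal_mult')
  finally have g1: "(\<integral>\<^sup>+x. ennreal (?g x) \<partial>m) = 1" .
  have "- ln_ext N \<le> renyi_divergence m \<alpha> ?g ?Q"
    unfolding N_def
  proof (rule renyi_divergence_ge)
    show "?g \<in> borel_measurable m"
      unfolding g_def by measurable
    show "0 \<le> ?g x" if "x \<in> space m" for x
      unfolding g_def using Z_pos pref_nonneg[where t = "\<theta> k" and p = p, OF ctxt] p_nonneg[OF \<theta>_k that] by simp
    show "(\<integral>\<^sup>+x. ennreal (?Q x) * indicator {x. ?g x \<noteq> 0} x \<partial>m) \<noteq> \<top>"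
      using N_le unfolding N_def by (auto simp: top_unique)
  qed (use p_nonneg[OF \<theta>_Suc_k] g1 \<alpha> in auto)
  then have "- ln_ext N + ereal \<Delta> \<le> renyi_divergence m \<alpha> ?g ?Q + ereal \<Delta>"
    by (rule add_right_mono)
  also have "\<dots> \<le> ereal (- ln ?Z)"
    using progress unfolding Dk .
  finally have ineq: "- ln_ext N + ereal \<Delta> \<le> ereal (- ln ?Z)" .
  \<comment> \<open>For \<open>N = 0\<close> the left side of \<open>ineq\<close> would be
    \<open>\<infinity>\<close>, while its right side is finite. Here it matters that
    \<open>ln_ext\<close> sends 0 to \<open>-\<infinity>\<close>.\<close>
  have "N \<noteq> 0"
    using ineq by (auto simp: ln_ext_def)
  moreover obtain n where n: "N = ennreal n" "0 \<le> n"
    using N_le by (cases N) (auto simp: top_unique)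
  ultimately have "0 < n" by (cases "n = 0") auto
  with ineq have "\<Delta> + ln ?Z \<le> ln n"
    by (simp add: n ln_ext_def)
  then have "exp (\<Delta> + ln ?Z) \<le> exp (ln n)"
    by simp
  then have "exp \<Delta> * ?Z \<le> n"
    using \<open>0 < n\<close> Z_pos by (simp add: exp_add)
  also have "n \<le> ?J"
    using N_le \<open>0 < n\<close> unfolding n by (simp add: ennreal_le_iff2)
  finally have main: "exp \<Delta> * ?Z \<le> ?J" .
  have "?Z < ?J" if "\<Delta> > 0"
  proof -
    have "1 * ?Z < exp \<Delta> * ?Z"
      using that Z_pos by (intro mult_strict_right_mono) auto
    with main show ?thesis by simp
  qed
  with main Jk show ?thesis by simp
qed
end
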